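(* For every real $\tau\geq 0$, \[ \dim_H L(\tau)=\frac{1}{1+\tau}\qquad\text{and}\qquad \mathcal{H}^{1/(1+\tau)}\big(L(\tau)\big)=+\infty, \] where $\dim_H$ denotes Hausdorff dimension and $\mathcal{H}^s$ the $s$-dimensional Hausdorff measure.
   Context: Every $x\in(0,1]$ has a unique Lüroth expansion $x=\sum_{k=1}^\infty \frac{1}{d_k\prod_{j=1}^{k-1}d_j(d_j-1)}$ with digits $d_k=d_k(x)\in\{2,3,4,\dots\}$ (generated by the Lüroth map $T(x)=\lfloor 1/x\rfloor(\lfloor 1/x+1\rfloor x-1)$, with $d_1(x)=\lfloor 1/x\rfloor+1$ and $d_n(x)=d_1(T^{n-1}x)$). For $n\in\mathbb{N}$ define $Q_n(x)=d_n\prod_{j=1}^{n-1}d_j(d_j-1)$ (empty product $=1$) and $P_n(x)=Q_n(x)\sum_{k=1}^n \frac{1}{d_k\prod_{j=1}^{k-1}d_j(d_j-1)}$, so $P_n(x)/Q_n(x)$ is the $n$-th Lüroth convergent of $x$. For $\tau\ge 0$, \[ L(\tau)=\limsup_{n\to\infty}\Big\{x\in(0,1]: \Big|x-\frac{P_n(x)}{Q_n(x)}\Big|<\frac{1}{Q_n(x)^{1+\tau}}\Big\}, \] i.e. the set of $x\in(0,1]$ for which the inequality holds for infinitely many $n$.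
   Formalization: The claim that the Hausdorff measure is infinite is made only for τ > 0, since at τ = 0 it fails: L(0) lies in (0,1], so its 1-dimensional Hausdorff measure is at most 1. The dimension formula is kept for every τ ≥ 0. *)

theory Defs
  imports "HOL-Analysis.Analysis"
begin

section \<open>Hausdorff measure and dimension\<close>

text \<open>
  The usual convention \<open>diam(U)^0 = 1\<close> for nonempty \<open>U\<close> (also for singletons) has to be imposed
  explicitly, because \<open>0 powr 0 = 0\<close>.
\<close>

definition hausdorff_gauge :: "real \<Rightarrow> 'a::metric_space set \<Rightarrow> ennreal" where
  "hausdorff_gauge s U =
     (if U = {} then 0 else if s = 0 then 1 else ennreal (diameter U powr s))"

text \<open>
  Boundedness is required separately because \<open>diameter\<close> is unspecified on unbounded sets. Finite
  covers are included, since the empty set may occur in a cover.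
\<close>

definition hausdorff_covers :: "real \<Rightarrow> 'a::metric_space set \<Rightarrow> (nat \<Rightarrow> 'a set) set" where
  "hausdorff_covers \<delta> E =
     {U. E \<subseteq> (\<Union>i. U i) \<and> (\<forall>i. bounded (U i) \<and> diameter (U i) \<le> \<delta>)}"

definition hausdorff_premeasure :: "real \<Rightarrow> real \<Rightarrow> 'a::metric_space set \<Rightarrow> ennreal" where
  "hausdorff_premeasure s \<delta> E = (INF U\<in>hausdorff_covers \<delta> E. \<Sum>i. hausdorff_gauge s (U i))"

definition hausdorff_measure :: "real \<Rightarrow> 'a::metric_space set \<Rightarrow> ennreal" where
  "hausdorff_measure s E = (SUP \<delta>\<in>{0<..}. hausdorff_premeasure s \<delta> E)"

definition hausdorff_dim :: "'a::metric_space set \<Rightarrow> ennreal" where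
  "hausdorff_dim E = (INF s\<in>{s. 0 \<le> s \<and> hausdorff_measure s E = 0}. ennreal s)"


section \<open>Lueroth expansions\<close>

definition luroth_map :: "real \<Rightarrow> real" where
  "luroth_map x = of_int \<lfloor>1 / x\<rfloor> * (of_int \<lfloor>1 / x + 1\<rfloor> * x - 1)"

text \<open>
  Digits are indexed from 1. The values at index 0 below are irrelevant: \<open>luroth_limsup\<close> only
  depends on all sufficiently large indices.
\<close>

definition luroth_digit :: "nat \<Rightarrow> real \<Rightarrow> nat" where
  "luroth_digit n x = nat \<lfloor>1 / (luroth_map ^^ (n - 1)) x\<rfloor> + 1"

definition luroth_Q :: "nat \<Rightarrow> real \<Rightarrow> nat" where
  "luroth_Q n x = luroth_digit n x * (\<Prod>j=1..<n. luroth_digit j x * (luroth_digit j x - 1))"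

definition luroth_P :: "nat \<Rightarrow> real \<Rightarrow> real" where
  "luroth_P n x = real (luroth_Q n x) *
     (\<Sum>k=1..n. 1 / real (luroth_digit k x *
                          (\<Prod>j=1..<k. luroth_digit j x * (luroth_digit j x - 1))))"

definition luroth_limsup :: "real \<Rightarrow> real set" where
  "luroth_limsup \<tau> =
     {x \<in> {0<..1}. \<exists>\<^sub>\<infinity>n. \<bar>x - luroth_P n x / real (luroth_Q n x)\<bar>
                              < 1 / real (luroth_Q n x) powr (1 + \<tau>)}"

text \<open>
  Subsets of the unit interval have one-dimensional Hausdorff measure at most 1. Hence
  \<open>hausdorff_measure (1 / (1 + \<tau>)) (luroth_limsup \<tau>)\<close> is finite for \<open>\<tau> = 0\<close>.
\<close>

lemma hausdorff_measure_1_le_1: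
  fixes E :: "real set"
  assumes "E \<subseteq> {0<..1}"
  shows "hausdorff_measure 1 E \<le> 1"
  unfolding hausdorff_measure_def
proof (rule SUP_least)
  fix \<delta> :: real assume "\<delta> \<in> {0<..}"
  then obtain m where m: "inverse (real (Suc m)) < \<delta>"
    using reals_Archimedean[of \<delta>] by auto
  define n where "n = Suc m"
  have n: "n > 0" "1 / real n \<le> \<delta>" using m by (auto simp: n_def inverse_eq_divide)
  define U where "U = (\<lambda>i. if i < n then {real i / n .. (real i + 1) / n} else {})"
  have diam: "diameter (U i) = 1 / n" if "i < n" for i
    using that n(1) by (simp add: U_def divide_right_mono field_simps)
  have "x \<in> (\<Union>i. U i)" if "x \<in> E" for x
  proof -
    have x: "0 < x" "x \<le> 1" using that assms by auto
    define i where "i = nat (\<lceil>x * n\<rceil> - 1)"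
    have pos: "0 < x * n" using x n by simp
    have le: "x * n \<le> n" using x n by (simp add: mult_left_le_one_le)
    have "\<lceil>x * n\<rceil> \<le> int n" using le by (simp add: ceiling_le_iff)
    moreover have "\<lceil>x * n\<rceil> \<ge> 1" using pos by linarith
    ultimately have i: "i < n" "real i = of_int \<lceil>x * n\<rceil> - 1"
      using n by (auto simp: i_def)
    have "real i \<le> x * n" "x * n \<le> real i + 1" unfolding i(2) by linarith+
    then have "x \<in> U i" using i(1) n by (auto simp: U_def field_simps)
    then show ?thesis by blast
  qed
  moreover have "bounded (U i) \<and> diameter (U i) \<le> \<delta>" for i
    using diam[of i] n \<open>\<delta> \<in> {0<..}\<close> by (cases "i < n") (auto simp: U_def)
  ultimately have "U \<in> hausdorff_covers \<delta> E" by (auto simp: hausdorff_covers_def)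
  then have "hausdorff_premeasure 1 \<delta> E \<le> (\<Sum>i. hausdorff_gauge 1 (U i))"
    unfolding hausdorff_premeasure_def by (rule INF_lower)
  also have "\<dots> = (\<Sum>i<n. hausdorff_gauge 1 (U i))"
    by (rule suminf_finite) (auto simp: U_def hausdorff_gauge_def)
  also have "\<dots> \<le> (\<Sum>i<n. ennreal (1 / n))"
    by (rule sum_mono) (simp add: hausdorff_gauge_def diam)
  also have "\<dots> = 1"
    using n by (simp add: ennreal_of_nat_eq_real_of_nat flip: ennreal_mult)
  finally show "hausdorff_premeasure 1 \<delta> E \<le> 1" .
qed

end

theory Submission
  imports Defs
begin

text \<open>
  For the upper bound, put \<open>t = (1 + \<tau>) s > 1\<close>. The sum of \<open>Q\<^sub>n powr - t\<close> over all admissible digit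
  words is a geometric series with ratio \<open>(\<Sum>d\<ge>2. (d (d - 1)) powr - t) < 1\<close> times a convergent
  series in the last digit, so the convergence part of the Borel--Cantelli argument applies.

  For the infinite measure, let \<open>s = 1 / (1 + \<tau>)\<close> and let intervals of lengths \<open>w i\<close> be given with
  \<open>(\<Sum>i. w i powr s)\<close> finite and \<open>(\<Sum>i. w i) < 1\<close>. A point of the limsup set outside all of them
  is found as a limit of nested intervals, each not covered up to measure zero. In such an interval
  consider cylinders of high level. The points with next digit 2 and close to the convergent form,
  in a cylinder of length \<open>l\<close>, an interval of length \<open>p = (l / 2) powr (1 + \<tau>)\<close>, so
  \<open>p powr s = l / 2\<close> is comparable to \<open>l\<close>. Averaging over the cylinders with respect to Lebesgue
  measure, the part of the cover that is not avoided, having small total \<open>w i powr s\<close>, meets one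
  of these short intervals in intervals with total \<open>w i powr s\<close> less than \<open>p powr s\<close>, hence does
  not cover it. All exponents below \<open>1 / (1 + \<tau>)\<close> reduce to this by monotonicity in \<open>\<tau>\<close>.
\<close>

section \<open>Hausdorff measure\<close>

lemma hausdorff_gauge_eq:
  assumes "s \<noteq> 0"
  shows "hausdorff_gauge s U = ennreal (diameter U powr s)"
  using assms by (simp add: hausdorff_gauge_def)

lemma hausdorff_measure_mono:
  assumes "E \<subseteq> F"
  shows "hausdorff_measure s E \<le> hausdorff_measure s F"
  unfolding hausdorff_measure_def hausdorff_premeasure_def
  using assms by (intro SUP_mono' INF_superset_mono) (auto simp: hausdorff_covers_def)

text \<open>At exponent 0 a nonempty covering set has gauge 1. This handles exponent 0 in the lower
  bound for the dimension.\<close>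

lemma hausdorff_measure_0_ge_1:
  assumes "E \<noteq> {}"
  shows "1 \<le> hausdorff_measure 0 E"
proof -
  have "1 \<le> hausdorff_premeasure 0 1 E"
    unfolding hausdorff_premeasure_def
  proof (rule INF_greatest)
    fix U assume "U \<in> hausdorff_covers 1 E"
    then have "\<exists>i. U i \<noteq> {}"
      using assms unfolding hausdorff_covers_def by fast
    then obtain i where "U i \<noteq> {}" ..
    then have "1 = (\<Sum>i\<in>{i}. hausdorff_gauge 0 (U i))"
      by (simp add: hausdorff_gauge_def)
    also have "\<dots> \<le> (\<Sum>i. hausdorff_gauge 0 (U i))"
      by (rule sum_le_suminf) auto
    finally show "1 \<le> (\<Sum>i. hausdorff_gauge 0 (U i))" .
  qed
  also have "\<dots> \<le> hausdorff_measure 0 E"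
    unfolding hausdorff_measure_def by (rule SUP_upper) simp
  finally show ?thesis .
qed

text \<open>The convergence half of Borel--Cantelli: every tail of \<open>U\<close> covers
  \<open>E\<close>, and along the tails both the total gauge and the diameters become arbitrarily
  small.\<close>

lemma hausdorff_measure_limsup_eq_0:
  fixes U :: "nat \<Rightarrow> 'a::metric_space set"
  assumes s: "0 < s" and bd: "\<And>i. bounded (U i)"
    and sm: "summable (\<lambda>i. diameter (U i) powr s)"
    and E: "\<And>x. x \<in> E \<Longrightarrow> \<exists>\<^sub>\<infinity>i. x \<in> U i"
  shows "hausdorff_measure s E = 0"
proof -
  have small: "hausdorff_premeasure s \<delta> E \<le> ennreal e" if "0 < \<delta>" "0 < e" for \<delta> e
  proof -
    have "\<forall>\<^sub>F n in sequentially. (\<Sum>k. diameter (U (k + n)) powr s) < e"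
      by (rule order_tendstoD[OF suminf_exist_split2[OF sm]]) fact
    moreover have "\<forall>\<^sub>F n in sequentially. \<forall>k\<ge>n. diameter (U k) powr s < \<delta> powr s"
      using that by (intro eventually_all_ge_at_top
        order_tendstoD(2)[OF summable_LIMSEQ_zero[OF sm]]) simp
    ultimately obtain n where n: "(\<Sum>k. diameter (U (k + n)) powr s) < e"
      "\<And>k. k \<ge> n \<Longrightarrow> diameter (U k) powr s < \<delta> powr s"
      using eventually_happens[OF eventually_conj] by fastforce
    have "diameter (U k) \<le> \<delta>" if "k \<ge> n" for k
      using n(2)[OF that] powr_less_cancel2[OF s _ _ n(2)[OF that]] \<open>0 < \<delta>\<close>
        diameter_ge_0[OF bd[of k]] by (cases "diameter (U k) = 0") auto
    moreover have "x \<in> (\<Union>i. U (i + n))" if x: "x \<in> E" for x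
    proof -
      obtain i where "i \<ge> n" "x \<in> U i"
        using E[OF x] unfolding INFM_nat_le by blast
      then have "x \<in> U ((i - n) + n)" by simp
      then show ?thesis by blast
    qed
    ultimately have "(\<lambda>i. U (i + n)) \<in> hausdorff_covers \<delta> E"
      by (auto simp: hausdorff_covers_def bd)
    then have "hausdorff_premeasure s \<delta> E \<le> (\<Sum>i. hausdorff_gauge s (U (i + n)))"
      unfolding hausdorff_premeasure_def by (rule INF_lower)
    also have "\<dots> = ennreal (\<Sum>i. diameter (U (i + n)) powr s)"
      using s sm by (subst suminf_ennreal2[symmetric])
        (auto simp: hausdorff_gauge_eq intro: summable_ignore_initial_segment)
    also have "\<dots> \<le> ennreal e"
      using n(1) by (intro ennreal_leI) simp
    finally show ?thesis .
  qed
  have "hausdorff_premeasure s \<delta> E \<le> 0" if "0 < \<delta>" for \<delta>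
    by (rule ennreal_le_epsilon) (simp add: small that)
  then show ?thesis
    by (simp add: hausdorff_measure_def)
qed

section \<open>The upper bound\<close>

lemma sum_inverse_consecutive:
  "(\<Sum>d<n. 1 / (real d * (real d - 1))) \<le> 1"
proof -
  \<comment> \<open>The sum telescopes from \<open>d = 2\<close> on. The terms at 0 and 1 vanish
    because division by 0 gives 0.\<close>
  have "(\<Sum>d<Suc (Suc n). 1 / (real d * (real d - 1))) = 1 - 1 / real (Suc n)" for n
  proof (induction n)
    case (Suc n)
    have "1 / (real (Suc (Suc n)) * (real (Suc (Suc n)) - 1)) = 1 / real (Suc n) - 1 / real (Suc (Suc n))"
      by (simp add: field_simps)
    with Suc show ?case by (subst sum.lessThan_Suc) linarith
  qed simp
  from this[of n] have "(\<Sum>d<Suc (Suc n). 1 / (real d * (real d - 1))) \<le> 1" by simp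
  moreover have "(\<Sum>d<n. 1 / (real d * (real d - 1))) \<le> (\<Sum>d<Suc (Suc n). 1 / (real d * (real d - 1)))"
    by (rule sum_mono2) (auto simp: zero_le_mult_iff)
  ultimately show ?thesis by linarith
qed

text \<open>The junk digits 0 and 1 get weight 0, because \<open>0 powr - t = 0\<close>.\<close>

definition digit_weight :: "real \<Rightarrow> nat \<Rightarrow> real" where
  "digit_weight t d = real (d * (d - 1)) powr - t"

text \<open>Splitting off exponent 1 leaves a factor of at most \<open>2 powr (1 - t)\<close>, as
  \<open>d * (d - 1) \<ge> 2\<close>, and the series with exponent 1 telescopes. The bound is the
  geometric ratio below 1.\<close>

lemma sum_digit_weight_le:
  assumes t: "1 < t" and "finite D"
  shows "(\<Sum>d\<in>D. digit_weight t d) \<le> 2 powr (1 - t)"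
proof -
  obtain n where n: "D \<subseteq> {..<n}"
    using \<open>finite D\<close> finite_nat_iff_bounded by blast
  have w: "digit_weight t d \<le> 2 powr (1 - t) * (1 / (real d * (real d - 1)))" for d
  proof (cases "d \<le> 1")
    case True
    then have "d = 0 \<or> d = 1" by auto
    then show ?thesis by (auto simp: digit_weight_def)
  next
    case False
    then have ge: "2 \<le> real d * (real d - 1)"
      using mult_mono[of 2 "real d" 1 "real d - 1"] by simp
    have "digit_weight t d = (real d * (real d - 1)) powr (1 - t) * (real d * (real d - 1)) powr - 1"
      unfolding powr_add[symmetric] using False by (simp add: digit_weight_def of_nat_diff)
    also have "\<dots> \<le> 2 powr (1 - t) * (real d * (real d - 1)) powr - 1"
      using ge t by (intro mult_right_mono powr_mono2') auto
    finally show ?thesis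
      using ge by (simp add: powr_minus divide_inverse)
  qed
  have "(\<Sum>d\<in>D. digit_weight t d) \<le> (\<Sum>d<n. digit_weight t d)"
    using n by (intro sum_mono2) (auto simp: digit_weight_def)
  also have "\<dots> \<le> 2 powr (1 - t) * (\<Sum>d<n. 1 / (real d * (real d - 1)))"
    unfolding sum_distrib_left by (intro sum_mono w)
  also have "\<dots> \<le> 2 powr (1 - t)"
    by (intro mult_right_le_one_le sum_inverse_consecutive sum_nonneg)
       (auto simp: zero_le_mult_iff)
  finally show ?thesis .
qed

lemma sum_prod_list_lists_length:
  fixes g :: "nat \<Rightarrow> real"
  assumes "finite D"
  shows "(\<Sum>w | set w \<subseteq> D \<and> length w = n. \<Prod>d\<leftarrow>w. g d) = (\<Sum>d\<in>D. g d) ^ n"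
proof (induction n)
  case 0
  have "{w. set w \<subseteq> D \<and> length w = 0} = {[]}" by auto
  then show ?case by simp
next
  case (Suc n)
  have "{w. set w \<subseteq> D \<and> length w = Suc n} =
      (\<lambda>(d, w). d # w) ` (D \<times> {w. set w \<subseteq> D \<and> length w = n})"
    by (auto simp: length_Suc_conv image_def)
  then have "(\<Sum>w | set w \<subseteq> D \<and> length w = Suc n. \<Prod>d\<leftarrow>w. g d) =
      (\<Sum>(d, w)\<in>D \<times> {w. set w \<subseteq> D \<and> length w = n}. g d * (\<Prod>d\<leftarrow>w. g d))"
    by (simp add: sum.reindex inj_on_def case_prod_unfold)
  also have "\<dots> = (\<Sum>d\<in>D. g d) * (\<Sum>w | set w \<subseteq> D \<and> length w = n. \<Prod>d\<leftarrow>w. g d)"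
    by (simp add: sum_product sum.cartesian_product)
  finally show ?case by (simp add: Suc)
qed

text \<open>A finite set of words uses finitely many digits and has bounded lengths, so its sum is
  dominated by a partial sum of the geometric series in \<open>\<rho>\<close>.\<close>

lemma summable_on_prod_list_lists:
  fixes g :: "nat \<Rightarrow> real"
  assumes g: "\<And>d. 0 \<le> g d" and \<rho>: "\<rho> < 1"
    and le: "\<And>D. finite D \<Longrightarrow> (\<Sum>d\<in>D. g d) \<le> \<rho>"
  shows "(\<lambda>w. \<Prod>d\<leftarrow>w. g d) summable_on UNIV"
proof (rule nonneg_bdd_above_summable_on)
  have pos: "0 \<le> (\<Prod>d\<leftarrow>w. g d)" for w
    by (induction w) (auto simp: g)
  then show "\<And>w. w \<in> UNIV \<Longrightarrow> 0 \<le> (\<Prod>d\<leftarrow>w. g d)" by simp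
  have \<rho>0: "0 \<le> \<rho>" using le[of "{}"] by simp
  show "bdd_above (sum (\<lambda>w. \<Prod>d\<leftarrow>w. g d) ` {F. F \<subseteq> UNIV \<and> finite F})"
  proof (rule bdd_aboveI2)
    fix F :: "nat list set" assume "F \<in> {F. F \<subseteq> UNIV \<and> finite F}"
    then have F: "finite F" by simp
    define D where "D = (\<Union>w\<in>F. set w)"
    have D: "finite D" using F by (simp add: D_def)
    obtain N where N: "length ` F \<subseteq> {..<N}"
      using F finite_nat_iff_bounded by (metis finite_imageI)
    have "(\<Sum>w\<in>F. \<Prod>d\<leftarrow>w. g d) \<le> (\<Sum>w\<in>(\<Union>n<N. {w. set w \<subseteq> D \<and> length w = n}). \<Prod>d\<leftarrow>w. g d)"
      using D N by (intro sum_mono2) (auto simp: D_def pos finite_lists_length_eq)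
    also have "\<dots> = (\<Sum>n<N. \<Sum>w | set w \<subseteq> D \<and> length w = n. \<Prod>d\<leftarrow>w. g d)"
      using D by (intro sum.UNION_disjoint) (auto simp: finite_lists_length_eq)
    also have "\<dots> = (\<Sum>n<N. (\<Sum>d\<in>D. g d) ^ n)"
      using D by (simp add: sum_prod_list_lists_length)
    also have "\<dots> \<le> (\<Sum>n<N. \<rho> ^ n)"
      using D g by (intro sum_mono power_mono le sum_nonneg)
    also have "\<dots> \<le> (\<Sum>n. \<rho> ^ n)"
      using \<rho> \<rho>0 by (intro sum_le_suminf) auto
    finally show "(\<Sum>w\<in>F. \<Prod>d\<leftarrow>w. g d) \<le> (\<Sum>n. \<rho> ^ n)" .
  qed
qed

section \<open>Covering the limsup set by digit words\<close>

definition luroth_prefix :: "nat \<Rightarrow> real \<Rightarrow> nat list" where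
  "luroth_prefix n x = map (\<lambda>j. luroth_digit j x) [1..<n]"

lemma luroth_prefix_eq_iff:
  "luroth_prefix n x = luroth_prefix n y \<longleftrightarrow> (\<forall>j\<in>{1..<n}. luroth_digit j x = luroth_digit j y)"
  by (auto simp: luroth_prefix_def)

lemma luroth_P_Q_cong:
  assumes n: "1 \<le> n" and eq: "\<And>j. j \<in> {1..n} \<Longrightarrow> luroth_digit j x = luroth_digit j y"
  shows "luroth_P n x = luroth_P n y" "luroth_Q n x = luroth_Q n y"
proof -
  show Q: "luroth_Q n x = luroth_Q n y"
    using n eq by (auto simp: luroth_Q_def)
  show "luroth_P n x = luroth_P n y"
    using eq unfolding luroth_P_def Q by (auto intro!: sum.cong prod.cong)
qed

lemma luroth_Q_prefix:
  "luroth_Q n x = luroth_digit n x * (\<Prod>d\<leftarrow>luroth_prefix n x. d * (d - 1))"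
  using prod.distinct_set_conv_list[of "[1..<n]" "\<lambda>j. luroth_digit j x * (luroth_digit j x - 1)"]
  by (simp add: luroth_Q_def luroth_prefix_def o_def)

lemma real_prod_list:
  "real (\<Prod>d\<leftarrow>w. f d) = (\<Prod>d\<leftarrow>w. real (f d))"
  by (induction w) auto

lemma powr_prod_list:
  "(\<Prod>d\<leftarrow>w. real (f d)) powr t = (\<Prod>d\<leftarrow>w. real (f d) powr t)"
proof (induction w)
  case (Cons d w)
  have "0 \<le> (\<Prod>d\<leftarrow>w. real (f d))" by (induction w) auto
  with Cons show ?case by (simp add: powr_mult)
qed simp

text \<open>Points sharing their first \<open>n\<close> digits share the \<open>n\<close>-th
  convergent, so the approximation condition confines them to a set of diameter at most twice the
  radius. The \<open>s\<close>-th power of the radius factorises over the digits.\<close>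

lemma hausdorff_measure_luroth_limsup_eq_0:
  assumes "0 \<le> \<tau>" and s: "1 / (1 + \<tau>) < s"
  shows "hausdorff_measure s (luroth_limsup \<tau>) = 0"
proof -
  define t where "t = (1 + \<tau>) * s"
  have t: "1 < t" using assms by (simp add: t_def field_simps)
  have s0: "0 < s" using assms by (smt (verit) divide_pos_pos)
  \<comment> \<open>The cover is indexed by the first \<open>n - 1\<close> digits and the last digit, as the latter
    enters \<open>Q\<^sub>n\<close> only linearly.\<close>
  define w where "w = (\<lambda>(v, d). (\<Prod>d\<leftarrow>v. digit_weight t d) * real d powr - t)"
  define U where "U = (\<lambda>(v, d). {x. luroth_prefix (Suc (length v)) x = v \<and>
    luroth_digit (Suc (length v)) x = d \<and>
    \<bar>x - luroth_P (Suc (length v)) x / real (luroth_Q (Suc (length v)) x)\<bar>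
      < 1 / real (luroth_Q (Suc (length v)) x) powr (1 + \<tau>)})"
  have U: "bounded (U i) \<and> diameter (U i) powr s \<le> 2 powr s * w i" for i
  proof (cases i)
    case (Pair v d)
    define r where "r = 1 / real (d * (\<Prod>d\<leftarrow>v. d * (d - 1))) powr (1 + \<tau>)"
    have r: "\<bar>x - luroth_P (Suc (length v)) x / real (luroth_Q (Suc (length v)) x)\<bar> < r" if "x \<in> U i" for x
      using that by (auto simp: U_def Pair r_def luroth_Q_prefix)
    have "dist x y \<le> 2 * r" if "x \<in> U i" "y \<in> U i" for x y
    proof -
      have j: "luroth_digit j x = luroth_digit j y" if "j \<in> {1..Suc (length v)}" for j
        using that \<open>x \<in> U i\<close> \<open>y \<in> U i\<close> luroth_prefix_eq_iff[of "Suc (length v)" x y]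
        by (cases "j = Suc (length v)") (auto simp: U_def Pair)
      show ?thesis
        using r[OF that(1)] r[OF that(2)] luroth_P_Q_cong[of "Suc (length v)" x y, OF _ j]
        unfolding dist_real_def by force
    qed
    note dist = this
    have bd: "bounded (U i)"
      unfolding bounded_two_points using dist by blast
    have diam: "diameter (U i) \<le> 2 * r"
      using dist by (intro diameter_le) (auto simp: r_def dist_real_def)
    have "diameter (U i) powr s \<le> (2 * r) powr s"
      using diam diameter_ge_0[OF bd] s0 by (intro powr_mono2) auto
    also have "\<dots> = 2 powr s * r powr s" by (rule powr_mult)
    also have "r powr s = real (d * (\<Prod>d\<leftarrow>v. d * (d - 1))) powr - t"
      unfolding r_def powr_minus_divide[symmetric] powr_powr by (simp only: t_def minus_mult_left)
    also have "\<dots> = real d powr - t * (\<Prod>d\<leftarrow>v. real (d * (d - 1))) powr - t"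
      by (simp add: real_prod_list powr_mult)
    also have "\<dots> = w i"
      unfolding powr_prod_list by (simp add: w_def Pair digit_weight_def)
    finally show ?thesis using bd by simp
  qed
  have last: "(\<lambda>d. real d powr - t) summable_on UNIV"
    using t by (subst summable_on_UNIV_nonneg_real_iff) (auto simp: summable_real_powr_iff)
  have prefix: "(\<lambda>v. \<Prod>d\<leftarrow>v. digit_weight t d) summable_on UNIV"
    using t sum_digit_weight_le[OF t]
    by (intro summable_on_prod_list_lists[where \<rho> = "2 powr (1 - t)"])
       (auto simp: digit_weight_def powr_less_one)
  have "w summable_on UNIV \<times> UNIV"
  proof (rule summable_on_SigmaI)
    show "((\<lambda>d. w (v, d)) has_sum (\<Prod>d\<leftarrow>v. digit_weight t d) * (\<Sum>\<^sub>\<infinity>d. real d powr - t)) UNIV" for v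
      using last by (simp add: w_def has_sum_cmult_right)
    show "(\<lambda>v. (\<Prod>d\<leftarrow>v. digit_weight t d) * (\<Sum>\<^sub>\<infinity>d. real d powr - t)) summable_on UNIV"
      using prefix by (rule summable_on_cmult_left)
    show "0 \<le> w (v, d)" for v d
      by (auto simp: w_def digit_weight_def intro!: mult_nonneg_nonneg prod_list_nonneg)
  qed
  define f where "f = from_nat_into (UNIV :: (nat list \<times> nat) set)"
  have f: "bij f"
    unfolding f_def by (rule bij_betw_from_nat_into) (auto simp: finite_prod infinite_UNIV_listI)
  have "summable (\<lambda>i. w (f i))"
    using \<open>w summable_on UNIV \<times> UNIV\<close> f
    by (intro summable_on_imp_summable) (simp add: summable_on_reindex_bij_betw)
  then have "summable (\<lambda>i. 2 powr s * w (f i))" by (rule summable_mult)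
  then have sm: "summable (\<lambda>i. diameter (U (f i)) powr s)"
    using U by (elim summable_comparison_test') auto
  have "\<exists>\<^sub>\<infinity>i. x \<in> U (f i)" if "x \<in> luroth_limsup \<tau>" for x
  proof -
    \<comment> \<open>Index 0 is discarded: it yields the same prefix and digit as index 1, so
      \<open>?h\<close> is not injective there.\<close>
    let ?A = "{n. 1 \<le> n \<and> \<bar>x - luroth_P n x / real (luroth_Q n x)\<bar> < 1 / real (luroth_Q n x) powr (1 + \<tau>)}"
    let ?h = "\<lambda>n. (luroth_prefix n x, luroth_digit n x)"
    have "infinite {n. \<bar>x - luroth_P n x / real (luroth_Q n x)\<bar> < 1 / real (luroth_Q n x) powr (1 + \<tau>)}"
      using that by (simp add: luroth_limsup_def INFM_iff_infinite)
    moreover have "{n. \<bar>x - luroth_P n x / real (luroth_Q n x)\<bar> < 1 / real (luroth_Q n x) powr (1 + \<tau>)} \<subseteq> insert 0 ?A"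
      by (auto simp: Suc_le_eq)
    ultimately have "infinite ?A"
      by (meson finite_insert finite_subset)
    moreover have "inj_on ?h ?A"
    proof (rule inj_onI)
      fix m n assume "m \<in> ?A" "n \<in> ?A" "?h m = ?h n"
      then have "length (luroth_prefix m x) = length (luroth_prefix n x)" by simp
      then show "m = n" using \<open>m \<in> ?A\<close> \<open>n \<in> ?A\<close> by (auto simp: luroth_prefix_def)
    qed
    ultimately have "infinite (?h ` ?A)" using finite_image_iff by blast
    moreover have "Suc (length (luroth_prefix n x)) = n" if "1 \<le> n" for n
      using that by (simp add: luroth_prefix_def)
    then have "?h ` ?A \<subseteq> {i. x \<in> U i}"
      by (auto simp: U_def)
    ultimately have "infinite {i. x \<in> U i}" using finite_subset by blast
    moreover have "f ` {i. x \<in> U (f i)} = {i. x \<in> U i}"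
      using f by (auto simp: bij_def surj_def image_iff) metis
    ultimately show ?thesis
      by (metis INFM_iff_infinite finite_imageI)
  qed
  with s0 U sm show ?thesis
    by (intro hausdorff_measure_limsup_eq_0[where U = "\<lambda>i. U (f i)"]) auto
qed

section \<open>Lueroth cylinders\<close>

lemma luroth_digit_eqI:
  assumes "2 \<le> d" "1 / real d < (luroth_map ^^ n) x" "(luroth_map ^^ n) x \<le> 1 / (real d - 1)"
  shows "luroth_digit (Suc n) x = d"
proof -
  define y where "y = (luroth_map ^^ n) x"
  have d: "0 < real d" "0 < real d - 1" using assms(1) by auto
  then have y: "0 < y" using assms(2) by (smt (verit) y_def divide_pos_pos)
  have "real d - 1 \<le> 1 / y" "1 / y < real d"
    using assms(2,3) d y by (auto simp: field_simps y_def[symmetric])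
  then have "\<lfloor>1 / y\<rfloor> = int d - 1" by linarith
  then show ?thesis using assms(1) by (simp add: luroth_digit_def y_def[symmetric])
qed

text \<open>The last fact is the affine form of the branch with digit \<open>d\<close>, which
  vanishes at the left end of its interval.\<close>

lemma luroth_digit_bounds:
  fixes x :: real and n :: nat
  defines "y \<equiv> (luroth_map ^^ n) x" and "d \<equiv> luroth_digit (Suc n) x"
  assumes y: "0 < y" "y \<le> 1"
  shows "2 \<le> d" "1 / real d < y" "y \<le> 1 / (real d - 1)"
    and "luroth_map y = real (d * (d - 1)) * (y - 1 / real d)"
proof -
  have "1 \<le> 1 / y" using y by simp
  then have fl: "1 \<le> \<lfloor>1 / y\<rfloor>" by simp
  have d: "d = nat \<lfloor>1 / y\<rfloor> + 1" by (simp add: d_def y_def luroth_digit_def)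
  show d2: "2 \<le> d" using fl d by linarith
  have "int d = \<lfloor>1 / y\<rfloor> + 1" using fl d by linarith
  then have rd: "real d = of_int \<lfloor>1 / y\<rfloor> + 1" by (metis of_int_1 of_int_add of_int_of_nat_eq)
  have "1 / y < real d" "real d - 1 \<le> 1 / y" unfolding rd by linarith+
  then show "1 / real d < y" "y \<le> 1 / (real d - 1)"
    using y d2 by (auto simp: field_simps)
  have "luroth_map y = (real d - 1) * (real d * y - 1)"
    by (simp add: luroth_map_def rd)
  also have "real d * y - 1 = real d * (y - 1 / real d)"
    using d2 by (simp add: right_diff_distrib)
  finally show "luroth_map y = real (d * (d - 1)) * (y - 1 / real d)"
    using d2 by (simp add: of_nat_diff)
qed

text \<open>A branch interval has length \<open>1 / (d * (d - 1))\<close>, the inverse of the slope,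
  so no branch leaves the unit interval.\<close>

lemma luroth_iterate_bounds:
  assumes "x \<in> {0<..1}"
  shows "(luroth_map ^^ n) x \<in> {0<..1}"
proof (induction n)
  case (Suc n)
  then have y: "0 < (luroth_map ^^ n) x" "(luroth_map ^^ n) x \<le> 1" by auto
  define d where "d = luroth_digit (Suc n) x"
  have d: "2 \<le> d" "1 / real d < (luroth_map ^^ n) x" "(luroth_map ^^ n) x \<le> 1 / (real d - 1)"
    "luroth_map ((luroth_map ^^ n) x) = real (d * (d - 1)) * ((luroth_map ^^ n) x - 1 / real d)"
    unfolding d_def using luroth_digit_bounds[OF y] .
  have "real (d * (d - 1)) * ((luroth_map ^^ n) x - 1 / real d) 
      \<le> real (d * (d - 1)) * (1 / (real d - 1) - 1 / real d)"
    using d by (intro mult_left_mono) auto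
  also have "\<dots> = 1"
    using d(1) by (simp add: of_nat_diff field_simps)
  finally show ?case using d by simp
qed (use assms in simp)

lemma luroth_digit_ge_2:
  assumes "x \<in> {0<..1}" "1 \<le> n"
  shows "2 \<le> luroth_digit n x"
  using luroth_digit_bounds(1)[of "n - 1" x] luroth_iterate_bounds[OF assms(1), of "n - 1"] assms(2)
  by simp

section \<open>Geometry of cylinders\<close>

definition luroth_len :: "nat \<Rightarrow> real \<Rightarrow> real" where
  "luroth_len n x = 1 / real (\<Prod>j=1..n. luroth_digit j x * (luroth_digit j x - 1))"

text \<open>The left endpoint of the cylinder of the first \<open>n\<close> digits, whose length is
  \<open>luroth_len n x\<close>. By \<open>luroth_convergent_eq\<close> it is also the
  \<open>n\<close>-th convergent.\<close>

definition luroth_left :: "nat \<Rightarrow> real \<Rightarrow> real" where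
  "luroth_left n x = (\<Sum>k=1..n. luroth_len (k - 1) x / real (luroth_digit k x))"

lemma luroth_len_0 [simp]: "luroth_len 0 x = 1"
  by (simp add: luroth_len_def)

lemma luroth_left_0 [simp]: "luroth_left 0 x = 0"
  by (simp add: luroth_left_def)

lemma luroth_len_Suc:
  "luroth_len (Suc n) x = luroth_len n x / real (luroth_digit (Suc n) x * (luroth_digit (Suc n) x - 1))"
  by (simp add: luroth_len_def)

lemma luroth_left_Suc:
  "luroth_left (Suc n) x = luroth_left n x + luroth_len n x / real (luroth_digit (Suc n) x)"
  by (simp add: luroth_left_def)

lemma luroth_len_left_cong:
  assumes "\<And>j. j \<in> {1..n} \<Longrightarrow> luroth_digit j x = luroth_digit j y"
  shows "luroth_len n x = luroth_len n y" "luroth_left n x = luroth_left n y"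
proof -
  have len: "luroth_len m x = luroth_len m y" if "m \<le> n" for m
    using assms that by (simp add: luroth_len_def)
  then show "luroth_len n x = luroth_len n y" by simp
  show "luroth_left n x = luroth_left n y"
    using assms len by (auto simp: luroth_left_def intro!: sum.cong)
qed

lemma luroth_len_pos:
  assumes "x \<in> {0<..1}"
  shows "0 < luroth_len n x"
proof (induction n)
  case (Suc n)
  then show ?case
    using luroth_digit_ge_2[OF assms, of "Suc n"] by (simp add: luroth_len_Suc)
qed simp

lemma luroth_len_le:
  assumes x: "x \<in> {0<..1}"
  shows "luroth_len n x \<le> (1 / 2) ^ n"
proof (induction n)
  case (Suc n)
  have "2 * 1 \<le> luroth_digit (Suc n) x * (luroth_digit (Suc n) x - 1)"
    using luroth_digit_ge_2[OF x, of "Suc n"] by (intro mult_le_mono) auto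
  then have "luroth_len n x / real (luroth_digit (Suc n) x * (luroth_digit (Suc n) x - 1)) \<le> luroth_len n x / 2"
    using luroth_len_pos[OF x, of n] luroth_digit_ge_2[OF x, of "Suc n"]
    by (intro divide_left_mono) (simp_all del: of_nat_mult)
  then show ?case
    using Suc by (simp add: luroth_len_Suc)
qed simp

text \<open>Undoing the affine branches one by one; the product is the exact error of the
  \<open>n\<close>-th convergent.\<close>

lemma luroth_expansion:
  assumes x: "x \<in> {0<..1}"
  shows "x = luroth_left n x + luroth_len n x * (luroth_map ^^ n) x"
proof (induction n)
  case (Suc n)
  have y: "0 < (luroth_map ^^ n) x" "(luroth_map ^^ n) x \<le> 1"
    using luroth_iterate_bounds[OF x, of n] by auto
  define d where "d = luroth_digit (Suc n) x"
  have D: "real (d * (d - 1)) \<noteq> 0"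
    using luroth_digit_bounds(1)[OF y] by (simp add: d_def)
  have "luroth_len (Suc n) x * (luroth_map ^^ Suc n) x
      = luroth_len n x / real (d * (d - 1)) * (real (d * (d - 1)) * ((luroth_map ^^ n) x - 1 / real d))"
    using luroth_digit_bounds(4)[OF y] by (simp add: luroth_len_Suc d_def)
  also have "\<dots> = luroth_len n x * (luroth_map ^^ n) x - luroth_len n x / real d"
    using D by (simp add: right_diff_distrib del: of_nat_mult)
  finally show ?case
    using Suc by (simp add: luroth_left_Suc d_def)
qed simp

lemma luroth_Q_eq:
  assumes "1 \<le> n"
  shows "real (luroth_Q n x) = real (luroth_digit n x) / luroth_len (n - 1) x"
proof -
  have "{1..<n} = {1..n - 1}" using assms by auto
  then show ?thesis by (simp add: luroth_Q_def luroth_len_def)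
qed

lemma luroth_convergent_eq:
  assumes x: "x \<in> {0<..1}" and n: "1 \<le> n"
  shows "luroth_P n x / real (luroth_Q n x) = luroth_left n x"
proof -
  have "0 < real (luroth_Q n x)"
    unfolding luroth_Q_eq[OF n]
    using luroth_digit_ge_2[OF x n] luroth_len_pos[OF x, of "n - 1"] by (intro divide_pos_pos) auto
  then have "luroth_Q n x \<noteq> 0" by simp
  moreover have "{1..<k} = {1..k - 1}" if "k \<in> {1..n}" for k :: nat
    using that by auto
  ultimately show ?thesis
    by (simp add: luroth_P_def luroth_left_def luroth_len_def mult.commute)
qed

text \<open>Open on the left and closed on the right, because the iterates in
  \<open>luroth_expansion\<close> are positive and at most 1.\<close>

definition luroth_cylinder :: "nat \<Rightarrow> real \<Rightarrow> real set" where
  "luroth_cylinder n x = {luroth_left n x<..luroth_left n x + luroth_len n x}"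

lemma luroth_cylinder_self:
  assumes "x \<in> {0<..1}"
  shows "x \<in> luroth_cylinder n x"
proof -
  let ?y = "(luroth_map ^^ n) x"
  have "0 < luroth_len n x * ?y" "luroth_len n x * ?y \<le> luroth_len n x"
    using luroth_len_pos[OF assms, of n] luroth_iterate_bounds[OF assms, of n]
    by (auto simp: mult_left_le)
  then show ?thesis
    using luroth_expansion[OF assms, of n] unfolding luroth_cylinder_def by simp
qed

text \<open>By induction: since \<open>1 / d + 1 / (d * (d - 1)) = 1 / (d - 1)\<close>, the next
  cylinder lies in the present one, and the expansion of \<open>y\<close> then puts its
  \<open>n\<close>-th iterate into the branch interval of \<open>d\<close>.\<close>

lemma luroth_digit_cylinder:
  assumes x: "x \<in> {0<..1}" and y: "y \<in> luroth_cylinder n x"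
  shows "y \<in> {0<..1} \<and> (\<forall>j\<in>{1..n}. luroth_digit j y = luroth_digit j x)"
  using y
proof (induction n)
  case 0
  then show ?case by (simp add: luroth_cylinder_def)
next
  case (Suc n)
  define d where "d = luroth_digit (Suc n) x"
  have d: "2 \<le> d" using luroth_digit_ge_2[OF x] by (simp add: d_def)
  have len: "0 < luroth_len n x" by (rule luroth_len_pos[OF x])
  have "1 / real d + 1 / real (d * (d - 1)) = 1 / (real d - 1)"
    using d by (simp add: of_nat_diff field_simps)
  then have "luroth_len n x / real d + luroth_len n x / real (d * (d - 1)) = luroth_len n x / (real d - 1)"
    by (metis distrib_left times_divide_eq_right mult_1_right)
  then have y: "luroth_left n x + luroth_len n x / real d < y"
      "y \<le> luroth_left n x + luroth_len n x / (real d - 1)"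
    using Suc.prems by (auto simp: luroth_cylinder_def luroth_len_Suc luroth_left_Suc d_def)
  have "0 \<le> luroth_len n x / real d" "luroth_len n x / (real d - 1) \<le> luroth_len n x / 1"
    using d len by (simp, intro divide_left_mono) auto
  with y have "y \<in> luroth_cylinder n x"
    by (auto simp: luroth_cylinder_def)
  then have IH: "y \<in> {0<..1}" "\<And>j. j \<in> {1..n} \<Longrightarrow> luroth_digit j y = luroth_digit j x"
    using Suc.IH by auto
  have "y = luroth_left n x + luroth_len n x * (luroth_map ^^ n) y"
    using luroth_expansion[OF IH(1), of n] luroth_len_left_cong[OF IH(2)] by simp
  with y have "luroth_len n x * (1 / real d) < luroth_len n x * (luroth_map ^^ n) y"
    "luroth_len n x * (luroth_map ^^ n) y \<le> luroth_len n x * (1 / (real d - 1))" by auto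
  then have "luroth_digit (Suc n) y = d"
    unfolding mult_less_cancel_left_pos[OF len] mult_le_cancel_left_pos[OF len]
    by (rule luroth_digit_eqI[OF d])
  with IH show ?case by (auto simp: d_def le_Suc_eq)
qed

text \<open>Lying in a common cylinder is thus symmetric, so a point and an endpoint of a covering
  interval can exchange roles.\<close>

lemma luroth_cylinder_cong:
  assumes "x \<in> {0<..1}" "y \<in> luroth_cylinder n x"
  shows "luroth_len n y = luroth_len n x" "luroth_left n y = luroth_left n x"
    "luroth_cylinder n y = luroth_cylinder n x"
  using luroth_len_left_cong[of n y x] luroth_digit_cylinder[OF assms]
  by (auto simp: luroth_cylinder_def)

section \<open>Approximation sets of a single level\<close>

definition luroth_approx :: "real \<Rightarrow> nat \<Rightarrow> real set" where
  "luroth_approx \<tau> n = {x \<in> {0<..1}. \<bar>x - luroth_P n x / real (luroth_Q n x)\<bar>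
                              < 1 / real (luroth_Q n x) powr (1 + \<tau>)}"

lemma luroth_limsup_eq: "luroth_limsup \<tau> = {x. \<exists>\<^sub>\<infinity>n. x \<in> luroth_approx \<tau> n}"
  by (auto simp: luroth_limsup_def luroth_approx_def INFM_nat)

text \<open>Right of the midpoint the next digit is 2. The midpoint is then the next convergent,
  with denominator \<open>2 / luroth_len n x\<close>, which gives the stated radius.\<close>

lemma luroth_approx_right_of_midpoint:
  assumes x: "x \<in> {0<..1}"
    and y: "luroth_left n x + luroth_len n x / 2 < y"
      "y < luroth_left n x + luroth_len n x / 2 + (luroth_len n x / 2) powr (1 + \<tau>)"
    and le: "y \<le> luroth_left n x + luroth_len n x"
  shows "y \<in> luroth_approx \<tau> (Suc n)"
proof -
  have len: "0 < luroth_len n x" by (rule luroth_len_pos[OF x])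
  have cyl: "y \<in> luroth_cylinder n x" using y le len by (auto simp: luroth_cylinder_def)
  have y01: "y \<in> {0<..1}" using luroth_digit_cylinder[OF x cyl] by simp
  note cong = luroth_cylinder_cong[OF x cyl]
  have "y = luroth_left n x + luroth_len n x * (luroth_map ^^ n) y"
    using luroth_expansion[OF y01, of n] cong by simp
  with y(1) le have "luroth_len n x * (1 / 2) < luroth_len n x * (luroth_map ^^ n) y"
    "luroth_len n x * (luroth_map ^^ n) y \<le> luroth_len n x * 1" by linarith+
  then have d: "luroth_digit (Suc n) y = 2"
    using len by (intro luroth_digit_eqI) auto
  have Q: "real (luroth_Q (Suc n) y) = 2 / luroth_len n x"
    using luroth_Q_eq[of "Suc n" y] d cong by simp
  have PQ: "luroth_P (Suc n) y / real (luroth_Q (Suc n) y) = luroth_left n x + luroth_len n x / 2"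
    using luroth_convergent_eq[OF y01, of "Suc n"] d cong by (simp add: luroth_left_Suc)
  have "1 / (2 / luroth_len n x) powr (1 + \<tau>) = (luroth_len n x / 2) powr (1 + \<tau>)"
    using len by (simp add: powr_divide)
  then show ?thesis
    unfolding luroth_approx_def mem_Collect_eq PQ unfolding Q using y y01 by simp
qed

text \<open>Denominators are at least 1, so a larger exponent is a stricter condition. This
  transfers infinite measure from larger parameters to smaller ones.\<close>

lemma luroth_limsup_antimono:
  assumes "0 \<le> \<tau>" "\<tau> \<le> \<tau>'"
  shows "luroth_limsup \<tau>' \<subseteq> luroth_limsup \<tau>"
proof -
  have "luroth_approx \<tau>' n \<subseteq> luroth_approx \<tau> n" for n
  proof
    fix x assume x: "x \<in> luroth_approx \<tau>' n"
    \<comment> \<open>For denominator 0 the bound would be \<open>1 / 0 = 0\<close>, and no absolute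
      value is below 0.\<close>
    have "luroth_Q n x \<noteq> 0"
    proof
      assume "luroth_Q n x = 0"
      with x show False by (simp add: luroth_approx_def)
    qed
    then have "1 \<le> real (luroth_Q n x)" by simp
    then have "1 / real (luroth_Q n x) powr (1 + \<tau>') \<le> 1 / real (luroth_Q n x) powr (1 + \<tau>)"
      using assms by (intro divide_left_mono powr_mono) auto
    with x show "x \<in> luroth_approx \<tau> n" by (auto simp: luroth_approx_def)
  qed
  then show ?thesis
    unfolding luroth_limsup_eq by (auto elim!: INFM_mono)
qed

section \<open>Infinite measure at the critical exponent\<close>

lemma compact_subset_pos_measure:
  fixes S :: "real set"
  assumes "S \<in> sets borel" "bounded S" "0 < emeasure lborel S"
  obtains C where "compact C" "C \<subseteq> S" "0 < emeasure lborel C"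
proof -
  have fin: "emeasure lborel S < \<infinity>" by (rule emeasure_bounded_finite) fact
  define e where "e = measure lborel S"
  have e: "emeasure lborel S = ennreal e"
    using fin by (simp add: e_def emeasure_eq_ennreal_measure)
  have "0 < e" using assms(3) by (simp add: e)
  have "S \<in> sets lebesgue" using assms(1) by simp
  then obtain C where C: "closed C" "C \<subseteq> S" "S - C \<in> lmeasurable" "emeasure lebesgue (S - C) < ennreal e"
    using \<open>0 < e\<close> by (rule sets_lebesgue_inner_closed)
  have "emeasure lborel (S - C) < ennreal e"
    using C assms(1) by (simp add: emeasure_completion)
  moreover have "emeasure lborel S \<le> emeasure lborel C + emeasure lborel (S - C)"
    using C assms(1) by (subst emeasure_Un'[symmetric]) (auto intro!: emeasure_mono)
  ultimately have "0 < emeasure lborel C"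
    by (cases "emeasure lborel C = 0") (auto simp: e zero_less_iff_neq_zero)
  moreover have "compact C"
    using C assms(2) bounded_subset by (auto simp: compact_eq_bounded_closed)
  ultimately show ?thesis
    using that C by simp
qed

text \<open>Interpolation between the trivial bounds \<open>w\<close> and \<open>p\<close>. It turns
  lengths into the \<open>s\<close>-th powers that the cover controls.\<close>

lemma emeasure_interval_inter_le:
  fixes p w s c :: real
  assumes "0 < p" "0 \<le> w" "0 < s" "s \<le> 1"
  shows "emeasure lborel ({a..a + w} \<inter> {c<..<c + p}) \<le> ennreal (p * (w / p) powr s)"
proof -
  have "emeasure lborel ({a..a + w} \<inter> {c<..<c + p}) \<le> ennreal (min w p)"
  proof -
    have "emeasure lborel ({a..a + w} \<inter> {c<..<c + p}) \<le> emeasure lborel {a..a + w}"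
      "emeasure lborel ({a..a + w} \<inter> {c<..<c + p}) \<le> emeasure lborel {c<..<c + p}"
      by (auto intro!: emeasure_mono)
    then show ?thesis using assms by (auto simp: min_def)
  qed
  also have "min w p \<le> p * (w / p) powr s"
  proof (cases "w \<le> p")
    case True
    then have "(w / p) powr 1 \<le> (w / p) powr s"
      using assms by (intro powr_mono') auto
    then show ?thesis using True assms by (simp add: field_simps)
  next
    case False
    then have "1 \<le> (w / p) powr s"
      using assms by (intro ge_one_powr_ge_zero) auto
    then show ?thesis using False assms by simp
  qed
  finally show ?thesis using ennreal_leI order_trans by blast
qed

text \<open>
  The sum controls the covering intervals inside the cylinder of \<open>x\<close>, and the enlarged intervals
  rule out those that are longer than the cylinder. Each term of the sum has integral at most
  \<open>2 * w i powr s\<close>, which is why some point of \<open>C\<close> works.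
\<close>

lemma exists_light_point:
  fixes a w :: "nat \<Rightarrow> real"
  assumes w: "\<And>i. 0 \<le> w i" "\<And>i. w i \<le> 1" and s: "0 < s" "s \<le> 1"
    and sm: "summable (\<lambda>i. w i powr s)"
    and C: "C \<in> sets borel" "ennreal (12 * (\<Sum>i. w i powr s)) < emeasure lborel C"
  obtains x where "x \<in> C" "\<And>i. x \<notin> {a i - 5 * w i..a i + 5 * w i}"
    "(\<Sum>i. ennreal (2 * w i powr s / luroth_len n (a i)) *
        indicator {x. a i \<in> {0<..1} \<and> x \<in> luroth_cylinder n (a i)} x) < 1"
proof -
  \<comment> \<open>With the cylinder of \<open>a i\<close> instead of that of \<open>x\<close>,
    each term is, as a function of \<open>x\<close>, a multiple of the indicator of a fixed
    interval, whose length cancels the denominator on integration.\<close>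
  define F where "F i x = ennreal (2 * w i powr s / luroth_len n (a i)) *
        indicator {x. a i \<in> {0<..1} \<and> x \<in> luroth_cylinder n (a i)} x" for i x
  define B where "B i = {a i - 5 * w i..a i + 5 * w i}" for i
  have meas: "{x. a i \<in> {0<..1} \<and> x \<in> luroth_cylinder n (a i)} \<in> sets borel" for i
  proof -
    have eq: "{x. a i \<in> {0<..1} \<and> x \<in> luroth_cylinder n (a i)} =
        (if a i \<in> {0<..1} then luroth_cylinder n (a i) else {})" by auto
    show ?thesis unfolding eq by (simp add: luroth_cylinder_def)
  qed
  have "F i \<in> borel_measurable borel" for i
    unfolding F_def
    by (intro borel_measurable_times_ennreal borel_measurable_const borel_measurable_indicator meas)
  then have [measurable]: "F i \<in> borel_measurable lborel" for i by simp
  have F: "(\<integral>\<^sup>+x. F i x \<partial>lborel) \<le> ennreal (2 * w i powr s)" for i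
  proof (cases "a i \<in> {0<..1}")
    case True
    then have len: "0 < luroth_len n (a i)" by (rule luroth_len_pos)
    have "(\<integral>\<^sup>+x. F i x \<partial>lborel) =
        ennreal (2 * w i powr s / luroth_len n (a i)) * emeasure lborel (luroth_cylinder n (a i))"
      using True meas[of i] unfolding F_def by (subst nn_integral_cmult_indicator) auto
    also have "\<dots> = ennreal (2 * w i powr s)"
      using len by (simp add: luroth_cylinder_def flip: ennreal_mult)
    finally show ?thesis by simp
  next
    case False
    then have "F i x = 0" for x by (auto simp: F_def indicator_def)
    then show ?thesis by simp
  qed
  have B: "emeasure lborel (B i) \<le> ennreal (10 * w i powr s)" for i
  proof -
    have "w i powr 1 \<le> w i powr s"
      using w[of i] s by (intro powr_mono') auto
    then show ?thesis using w[of i] by (auto simp: B_def intro!: ennreal_leI)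
  qed
  \<comment> \<open>If every point of \<open>C\<close> failed, the indicator of \<open>C\<close>
    would be at most the sum of both families. Their integrals are at most
    \<open>10 * w i powr s\<close> and \<open>2 * w i powr s\<close>, whence the 12.\<close>
  have "\<exists>x\<in>C. (\<forall>i. x \<notin> B i) \<and> (\<Sum>i. F i x) < 1"
  proof (rule ccontr)
    assume neg: "\<not> (\<exists>x\<in>C. (\<forall>i. x \<notin> B i) \<and> (\<Sum>i. F i x) < 1)"
    have "indicator C x \<le> (\<Sum>i. indicator (B i) x + F i x)" for x
    proof (cases "x \<in> C")
      case True
      show ?thesis
      proof (cases "\<exists>i. x \<in> B i")
        case True
        then obtain i where "x \<in> B i" by blast
        then have "indicator C x \<le> (\<Sum>i\<in>{i}. indicator (B i) x + F i x)"
          by (simp add: indicator_def)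
        also have "\<dots> \<le> (\<Sum>i. indicator (B i) x + F i x)"
          by (rule sum_le_suminf) auto
        finally show ?thesis .
      next
        case False
        then have "1 \<le> (\<Sum>i. F i x)" using neg \<open>x \<in> C\<close> by (auto simp: not_less)
        also have "\<dots> \<le> (\<Sum>i. indicator (B i) x + F i x)"
          by (intro suminf_le) auto
        finally show ?thesis using \<open>x \<in> C\<close> by simp
      qed
    qed simp
    then have "(\<integral>\<^sup>+x. indicator C x \<partial>lborel) \<le> (\<integral>\<^sup>+x. (\<Sum>i. indicator (B i) x + F i x) \<partial>lborel)"
      by (intro nn_integral_mono)
    also have "\<dots> = (\<Sum>i. \<integral>\<^sup>+x. indicator (B i) x + F i x \<partial>lborel)"
      by (rule nn_integral_suminf) (simp add: B_def)
    also have "\<dots> = (\<Sum>i. emeasure lborel (B i) + (\<integral>\<^sup>+x. F i x \<partial>lborel))"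
      by (subst nn_integral_add) (auto simp: B_def)
    also have "\<dots> \<le> (\<Sum>i. ennreal (12 * w i powr s))"
    proof (intro suminf_le)
      show "emeasure lborel (B i) + (\<integral>\<^sup>+x. F i x \<partial>lborel) \<le> ennreal (12 * w i powr s)" for i
        using add_mono[OF B[of i] F[of i]] by (simp flip: ennreal_plus)
    qed auto
    also have "\<dots> = ennreal (12 * (\<Sum>i. w i powr s))"
      using sm by (subst suminf_ennreal2) (auto simp: suminf_mult)
    finally show False using C by simp
  qed
  then show ?thesis using that unfolding F_def B_def by blast
qed

text \<open>One step of the nested construction, carried out in a small cylinder around a light
  point. Finitely many covering intervals are avoided outright; the others may meet
  \<open>J'\<close> but do not exhaust its measure.\<close>

lemma exists_interval_avoiding_cover:
  fixes a w :: "nat \<Rightarrow> real" and \<tau> s :: real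
  defines "s \<equiv> 1 / (1 + \<tau>)" and "V \<equiv> (\<Union>i. {a i..a i + w i})"
  assumes \<tau>: "0 < \<tau>" and w: "\<And>i. 0 \<le> w i" "\<And>i. w i \<le> 1"
    and sm: "summable (\<lambda>i. w i powr s)"
    and J: "open J" "J \<subseteq> {0<..<1}" "0 < emeasure lborel (J - V)"
  obtains J' n where "open J'" "closure J' \<subseteq> J" "m \<le> n" "J' \<subseteq> luroth_approx \<tau> n"
    "\<And>i. i < m \<Longrightarrow> J' \<inter> {a i..a i + w i} = {}" "0 < emeasure lborel (J' - V)"
proof -
  have s: "0 < s" "s \<le> 1" "(1 + \<tau>) * s = 1" using \<tau> by (auto simp: s_def)
  have V: "V \<in> sets borel" by (auto simp: V_def)
  have "bounded (J - V)"
    using J(2) bounded_subset[of "{0<..<1::real}" "J - V"] by auto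
  then obtain C where C: "compact C" "C \<subseteq> J - V" "0 < emeasure lborel C"
    using J V by (metis compact_subset_pos_measure borel_open sets.Diff)
  have "emeasure lborel C < \<infinity>"
    using C compact_imp_bounded by (intro emeasure_bounded_finite) auto
  then obtain \<gamma> where \<gamma>: "0 < \<gamma>" "emeasure lborel C = ennreal \<gamma>"
    using C(3) by (cases "emeasure lborel C") auto
  \<comment> \<open>The tail has to be small against the measure of \<open>C\<close> for
    \<open>exists_light_point\<close> to apply to the shifted cover.\<close>
  have "(\<lambda>N. 12 * (\<Sum>k. w (k + N) powr s)) \<longlonglongrightarrow> 12 * 0"
    by (intro tendsto_mult_left suminf_exist_split2 sm)
  then have "\<forall>\<^sub>F N in sequentially. 12 * (\<Sum>k. w (k + N) powr s) < \<gamma>"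
    using \<gamma> by (intro order_tendstoD) auto
  from eventually_happens[OF eventually_conj[OF this eventually_ge_at_top[of m]]]
  obtain N where N: "12 * (\<Sum>k. w (k + N) powr s) < \<gamma>" "m \<le> N" by auto
  define G where "G = J - (\<Union>i<N. {a i..a i + w i})"
  have "open G" unfolding G_def by (intro open_Diff J closed_UN) auto
  moreover have "C \<subseteq> G" using C by (auto simp: G_def V_def)
  ultimately obtain \<epsilon> where \<epsilon>: "0 < \<epsilon>" "(\<Union>x\<in>C. ball x \<epsilon>) \<subseteq> G"
    using compact_subset_open_imp_ball_epsilon_subset C(1) by blast
  \<comment> \<open>The first bound makes a cylinder meeting \<open>C\<close> fit into a ball of
    radius \<open>\<epsilon>\<close>; the second gives
    \<open>(l / 2) powr \<tau> \<le> 1 / 2\<close> and hence \<open>p \<le> l / 4\<close>.\<close>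
  have "0 < min \<epsilon> ((1 / 2) powr (1 / \<tau>))" using \<epsilon> by simp
  then have "\<exists>n0. (1 / 2) ^ n0 < min \<epsilon> ((1 / 2 :: real) powr (1 / \<tau>))"
    by (rule real_arch_pow_inv) simp
  then obtain n0 where n0: "(1 / 2) ^ n0 < min \<epsilon> ((1 / 2 :: real) powr (1 / \<tau>))" ..
  define n where "n = max n0 m"
  have "(1 / 2) ^ n \<le> (1 / 2 :: real) ^ n0"
    by (intro power_decreasing) (auto simp: n_def)
  with n0 have n: "(1 / 2) ^ n < \<epsilon>" "(1 / 2) ^ n < (1 / 2 :: real) powr (1 / \<tau>)"
    by linarith+
  have "m \<le> n" by (simp add: n_def)
  obtain x where x: "x \<in> C" "\<And>i. x \<notin> {a (i + N) - 5 * w (i + N)..a (i + N) + 5 * w (i + N)}"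
    "(\<Sum>i. ennreal (2 * w (i + N) powr s / luroth_len n (a (i + N))) *
        indicator {x. a (i + N) \<in> {0<..1} \<and> x \<in> luroth_cylinder n (a (i + N))} x) < 1"
  proof (rule exists_light_point[where w = "\<lambda>i. w (i + N)" and a = "\<lambda>i. a (i + N)" and C = C and n = n])
    show "summable (\<lambda>i. w (i + N) powr s)"
      using sm by (rule summable_ignore_initial_segment)
    show "C \<in> sets borel" using C(1) by (rule borel_compact)
    have "0 \<le> (\<Sum>k. w (k + N) powr s)"
      using \<open>summable (\<lambda>i. w (i + N) powr s)\<close> by (intro suminf_nonneg) auto
    then show "ennreal (12 * (\<Sum>i. w (i + N) powr s)) < emeasure lborel C"
      using N(1) by (simp add: \<gamma>(2) ennreal_less_iff)
  qed (use w s in auto)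
  define L l p where "L = luroth_left n x" and "l = luroth_len n x" and "p = (l / 2) powr (1 + \<tau>)"
  have x01: "x \<in> {0<..1}" using x(1) C(2) J(2) by auto
  have l: "0 < l" "l \<le> (1 / 2) ^ n"
    using luroth_len_pos[OF x01] luroth_len_le[OF x01] by (auto simp: l_def)
  have "(l / 2) powr \<tau> \<le> ((1 / 2) powr (1 / \<tau>)) powr \<tau>"
    using l n(2) \<tau> by (intro powr_mono2) auto
  then have "(l / 2) powr \<tau> \<le> 1 / 2" using \<tau> by (simp add: powr_powr)
  then have "l / 2 * (l / 2) powr \<tau> \<le> l / 2 * (1 / 2)"
    using l by (intro mult_left_mono) auto
  then have p: "0 < p" "p \<le> l / 4" using l by (auto simp: p_def powr_add)
  have ps: "p powr s = l / 2" using l s by (simp add: p_def powr_powr)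
  have xI: "L < x" "x \<le> L + l"
    using luroth_cylinder_self[OF x01, of n] by (auto simp: luroth_cylinder_def L_def l_def)
  have IG: "{L..L + l} \<subseteq> G"
  proof
    fix y assume "y \<in> {L..L + l}"
    then have "y \<in> ball x \<epsilon>" using xI l n(1) by (auto simp: dist_real_def)
    then show "y \<in> G" using \<epsilon>(2) x(1) by blast
  qed
  define J' where "J' = {L + l / 2<..<L + l / 2 + p}"
  have J'I: "J' \<subseteq> {L<..<L + l}" using l p by (auto simp: J'_def)
  have avoid: "J' \<inter> {a i..a i + w i} = {}" if "i < N" for i
  proof -
    have "J' \<subseteq> G" using J'I IG greaterThanLessThan_subseteq_atLeastAtMost_iff by force
    then show ?thesis using that unfolding G_def by blast
  qed
  have sub: "J' \<subseteq> luroth_approx \<tau> (Suc n)"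
  proof
    fix y assume "y \<in> J'"
    then show "y \<in> luroth_approx \<tau> (Suc n)"
      using luroth_approx_right_of_midpoint[OF x01, of n y \<tau>] J'I
      by (auto simp: J'_def L_def l_def p_def)
  qed
  have F: "emeasure lborel ({a (i + N)..a (i + N) + w (i + N)} \<inter> J') \<le>
      ennreal p * (ennreal (2 * w (i + N) powr s / luroth_len n (a (i + N))) *
        indicator {x. a (i + N) \<in> {0<..1} \<and> x \<in> luroth_cylinder n (a (i + N))} x)" for i
  proof (cases "{a (i + N)..a (i + N) + w (i + N)} \<inter> J' = {}")
    case False
    define b v where "b = a (i + N)" and "v = w (i + N)"
    obtain z where z: "b \<le> z" "z \<le> b + v" "z \<in> J'"
      using False by (auto simp: b_def v_def)
    \<comment> \<open>Otherwise \<open>z\<close> is within \<open>l \<le> 4 * v\<close> of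
      \<open>x\<close> and within \<open>v\<close> of \<open>b\<close>, so the enlarged interval
      contains \<open>x\<close>. This is the origin of the factor 5.\<close>
    have "v < l / 4"
    proof (rule ccontr)
      assume "\<not> v < l / 4"
      then have "x \<in> {b - 5 * v..b + 5 * v}" using xI z J'I by auto
      then show False using x(2)[of i] by (simp add: b_def v_def)
    qed
    \<comment> \<open>The interval reaches a point beyond the midpoint and is shorter than
      \<open>l / 4\<close>, so it starts inside the cylinder, and the indicator at \<open>x\<close>
      counts it.\<close>
    then have b: "b \<in> luroth_cylinder n x"
      using z l p by (auto simp: J'_def luroth_cylinder_def L_def[symmetric] l_def[symmetric])
    have b01: "b \<in> {0<..1}" using luroth_digit_cylinder[OF x01 b] by simp
    have "x \<in> luroth_cylinder n b"
      using luroth_cylinder_cong(3)[OF x01 b] luroth_cylinder_self[OF x01] by simp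
    moreover have "emeasure lborel ({b..b + v} \<inter> J') \<le> ennreal p * ennreal (2 * v powr s / l)"
    proof -
      have "l = 2 * p powr s" using ps by simp
      then have "(v / p) powr s = 2 * v powr s / l" by (simp add: powr_divide)
      moreover have "emeasure lborel ({b..b + v} \<inter> J') \<le> ennreal (p * (v / p) powr s)"
        unfolding J'_def using p w s by (intro emeasure_interval_inter_le) (auto simp: v_def)
      ultimately show ?thesis
        using p l by (simp only: ennreal_mult')
    qed
    ultimately show ?thesis
      using b01 luroth_cylinder_cong(1)[OF x01 b]
      by (simp add: b_def[symmetric] v_def[symmetric] l_def[symmetric])
  qed simp
  have "V \<inter> J' \<subseteq> (\<Union>i. {a (i + N)..a (i + N) + w (i + N)} \<inter> J')"
  proof
    fix y assume "y \<in> V \<inter> J'"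
    then obtain i where i: "y \<in> {a i..a i + w i}" "y \<in> J'" by (auto simp: V_def)
    then have "N \<le> i" using avoid[of i] by (cases "i < N") auto
    then have "y \<in> {a ((i - N) + N)..a ((i - N) + N) + w ((i - N) + N)} \<inter> J'" using i by simp
    then show "y \<in> (\<Union>i. {a (i + N)..a (i + N) + w (i + N)} \<inter> J')" by blast
  qed
  then have "emeasure lborel (V \<inter> J') \<le> emeasure lborel (\<Union>i. {a (i + N)..a (i + N) + w (i + N)} \<inter> J')"
    by (intro emeasure_mono) (auto simp: J'_def)
  also have "\<dots> \<le> (\<Sum>i. emeasure lborel ({a (i + N)..a (i + N) + w (i + N)} \<inter> J'))"
    by (intro emeasure_subadditive_countably) (auto simp: J'_def)
  also have "\<dots> \<le> (\<Sum>i. ennreal p * (ennreal (2 * w (i + N) powr s / luroth_len n (a (i + N))) *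
        indicator {x. a (i + N) \<in> {0<..1} \<and> x \<in> luroth_cylinder n (a (i + N))} x))"
    by (intro suminf_le F) auto
  also have "\<dots> < ennreal p * 1"
    unfolding ennreal_suminf_cmult using x(3) p by (intro ennreal_mult_strict_left_mono) auto
  also have "\<dots> = emeasure lborel J'" using p by (simp add: J'_def)
  finally have lt: "emeasure lborel (V \<inter> J') < emeasure lborel J'" .
  have "emeasure lborel J' = emeasure lborel (V \<inter> J') + emeasure lborel (J' - V)"
    using V by (subst plus_emeasure) (auto simp: J'_def intro!: arg_cong[where f = "emeasure lborel"])
  with lt have "0 < emeasure lborel (J' - V)"
    by (cases "emeasure lborel (J' - V) = 0") (auto simp: zero_less_iff_neq_zero)
  moreover have "closure J' \<subseteq> J"
  proof -
    have "closure J' \<subseteq> {L..L + l}" using J'I by (intro closure_minimal) auto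
    then show ?thesis using IG by (auto simp: G_def)
  qed
  ultimately show ?thesis
    using that[of J' "Suc n"] sub avoid N(2) \<open>m \<le> n\<close> by (auto simp: J'_def)
qed

section \<open>From covers to nested intervals\<close>

lemma bounded_subset_interval_diameter:
  fixes U :: "real set"
  assumes "bounded U"
  shows "\<exists>a. U \<subseteq> {a..a + diameter U}"
proof (cases "U = {}")
  case False
  have bdd: "bdd_below U" using assms by (rule bounded_imp_bdd_below)
  have "x \<le> Inf U + diameter U" if "x \<in> U" for x
  proof -
    have "x - diameter U \<le> Inf U"
    proof (rule cInf_greatest[OF False])
      fix y assume "y \<in> U"
      then show "x - diameter U \<le> y"
        using diameter_bounded_bound[OF assms \<open>x \<in> U\<close> \<open>y \<in> U\<close>] by (simp add: dist_real_def)
    qed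
    then show ?thesis by simp
  qed
  then have "U \<subseteq> {Inf U..Inf U + diameter U}"
    using cInf_lower[OF _ bdd] by auto
  then show ?thesis ..
qed auto

text \<open>A nested interval argument as for Baire's theorem. Total length below 1 leaves part of
  the unit interval of positive measure uncovered, and each step preserves such a part.\<close>

lemma luroth_limsup_not_covered:
  fixes a w :: "nat \<Rightarrow> real" and \<tau> :: real
  assumes \<tau>: "0 < \<tau>" and w: "\<And>i. 0 \<le> w i" "\<And>i. w i \<le> 1"
    and sm: "summable (\<lambda>i. w i powr (1 / (1 + \<tau>)))"
    and lt: "summable w" "(\<Sum>i. w i) < 1"
  obtains x where "x \<in> luroth_limsup \<tau>" "\<And>i. x \<notin> {a i..a i + w i}"
proof -
  define V where "V = (\<Union>i. {a i..a i + w i})"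
  have V: "V \<in> sets borel" by (auto simp: V_def)
  define good where "good J \<longleftrightarrow> open J \<and> J \<subseteq> {0<..<1} \<and> 0 < emeasure lborel (J - V)" for J
  \<comment> \<open>The index \<open>m\<close> drives both requirements, so that in the limit
    arbitrarily high levels occur and every covering interval is excluded.\<close>
  define next_to where "next_to m J J' \<longleftrightarrow> closure J' \<subseteq> J \<and>
    (\<exists>n\<ge>m. J' \<subseteq> luroth_approx \<tau> n) \<and> (\<forall>i<m. J' \<inter> {a i..a i + w i} = {})" for m J J'
  have "good {0<..<1}"
  proof -
    have "emeasure lborel V \<le> (\<Sum>i. emeasure lborel {a i..a i + w i})"
      unfolding V_def by (rule emeasure_subadditive_countably) auto
    also have "\<dots> = ennreal (\<Sum>i. w i)"
      using w lt by (simp add: suminf_ennreal2)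
    also have "\<dots> < 1" using lt(2) by (simp add: ennreal_less_one_iff)
    finally have "emeasure lborel V < 1" .
    have "1 = emeasure lborel {0<..<1::real}" by simp
    also have "\<dots> \<le> emeasure lborel (({0<..<1} - V) \<union> V)"
      using V by (intro emeasure_mono) auto
    also have "\<dots> \<le> emeasure lborel ({0<..<1} - V) + emeasure lborel V"
      using V by (intro emeasure_subadditive) auto
    finally have "0 < emeasure lborel ({0<..<1} - V)"
      using \<open>emeasure lborel V < 1\<close>
      by (cases "emeasure lborel ({0<..<1} - V) = 0") (auto simp: zero_less_iff_neq_zero)
    then show ?thesis by (simp add: good_def)
  qed
  moreover have "\<exists>J'. good J' \<and> next_to m J J'" if J: "good J" for J m
  proof -
    have J1: "open J" "J \<subseteq> {0<..<1}" "0 < emeasure lborel (J - (\<Union>i. {a i..a i + w i}))"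
      using J by (auto simp: good_def V_def)
    obtain J' n where J': "open J'" "closure J' \<subseteq> J" "m \<le> n" "J' \<subseteq> luroth_approx \<tau> n"
      "\<And>i. i < m \<Longrightarrow> J' \<inter> {a i..a i + w i} = {}"
      "0 < emeasure lborel (J' - (\<Union>i. {a i..a i + w i}))"
      using exists_interval_avoiding_cover[OF \<tau> w sm J1, of m] by blast
    have "J' \<subseteq> {0<..<1}" using J'(2) J1(2) closure_subset by blast
    then show ?thesis using J' unfolding good_def next_to_def V_def by blast
  qed
  ultimately obtain J where J: "\<And>m. good (J m)" "\<And>m. next_to m (J m) (J (Suc m))"
    using dependent_nat_choice[of "\<lambda>_. good" next_to] by metis
  have "J (Suc m) \<subseteq> J m" for m
    using J(2)[of m] closure_subset unfolding next_to_def by blast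
  then have anti: "J n \<subseteq> J m" if "m \<le> n" for m n
    using that by (rule lift_Suc_antimono_le)
  have "\<Inter>(range (\<lambda>m. closure (J m))) \<noteq> {}"
  proof (rule compact_nest)
    fix m
    have "bounded (J m)"
      using J(1)[of m] bounded_subset[of "{0<..<1::real}"] by (auto simp: good_def)
    then show "compact (closure (J m))" by simp
    show "closure (J m) \<noteq> {}" using J(1)[of m] by (auto simp: good_def)
    show "closure (J n) \<subseteq> closure (J m)" if "m \<le> n" for n
      using anti[OF that] by (rule closure_mono)
  qed
  then obtain x where "\<And>m. x \<in> closure (J m)" by blast
  \<comment> \<open>The closure of \<open>J (Suc m)\<close> lies in \<open>J m\<close>, so the limit
    point belongs to the open sets themselves.\<close>
  then have x: "x \<in> J m" for m
    using J(2)[of m] unfolding next_to_def by blast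
  have "\<exists>n\<ge>m. x \<in> luroth_approx \<tau> n" for m
    using J(2)[of m] x[of "Suc m"] unfolding next_to_def by blast
  then have "x \<in> luroth_limsup \<tau>"
    by (simp add: luroth_limsup_eq INFM_nat_le)
  moreover have "x \<notin> {a i..a i + w i}" for i
    using J(2)[of "Suc i"] x[of "Suc (Suc i)"] unfolding next_to_def by blast
  ultimately show ?thesis by (rule that)
qed

text \<open>As \<open>s < 1\<close>, a cover by sets of small diameter with \<open>s\<close>-sum
  below \<open>M\<close> has total length below 1, which contradicts
  \<open>luroth_limsup_not_covered\<close>.\<close>

lemma hausdorff_measure_luroth_limsup_eq_top:
  assumes \<tau>: "0 < \<tau>"
  shows "hausdorff_measure (1 / (1 + \<tau>)) (luroth_limsup \<tau>) = \<infinity>"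
proof -
  define s where "s = 1 / (1 + \<tau>)"
  have s: "0 < s" "s < 1" using \<tau> by (auto simp: s_def)
  have "ennreal M \<le> hausdorff_measure s (luroth_limsup \<tau>)" if M: "1 \<le> M" for M
  proof -
    \<comment> \<open>The solution of \<open>\<delta> powr (1 - s) * M = 1\<close>. Writing
      \<open>w i\<close> as \<open>w i powr (1 - s) * w i powr s\<close> then bounds the total
      length.\<close>
    define \<delta> where "\<delta> = (1 / M) powr (1 / (1 - s))"
    have \<delta>: "0 < \<delta>" "\<delta> \<le> 1" "\<delta> powr (1 - s) * M = 1"
      using M s by (auto simp: \<delta>_def powr_powr powr_le1)
    have "ennreal M \<le> hausdorff_premeasure s \<delta> (luroth_limsup \<tau>)"
      unfolding hausdorff_premeasure_def
    proof (rule INF_greatest)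
      fix U assume "U \<in> hausdorff_covers \<delta> (luroth_limsup \<tau>)"
      then have U: "luroth_limsup \<tau> \<subseteq> (\<Union>i. U i)" "\<And>i. bounded (U i)" "\<And>i. diameter (U i) \<le> \<delta>"
        by (auto simp: hausdorff_covers_def)
      define w where "w i = diameter (U i)" for i
      have w: "0 \<le> w i" "w i \<le> \<delta>" for i
        using U by (auto simp: w_def diameter_ge_0)
      have "\<exists>a. \<forall>i. U i \<subseteq> {a i..a i + w i}"
        unfolding w_def by (intro choice allI bounded_subset_interval_diameter U)
      then obtain a where a: "\<And>i. U i \<subseteq> {a i..a i + w i}" by blast
      show "ennreal M \<le> (\<Sum>i. hausdorff_gauge s (U i))"
      proof (rule ccontr)
        assume "\<not> ennreal M \<le> (\<Sum>i. hausdorff_gauge s (U i))"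
        then have lt: "(\<Sum>i. ennreal (w i powr s)) < ennreal M"
          using s by (simp add: hausdorff_gauge_eq w_def not_le)
        then have sm: "summable (\<lambda>i. w i powr s)"
          by (intro summable_suminf_not_top) auto
        have sum: "(\<Sum>i. w i powr s) < M"
          using lt sm M by (subst (asm) suminf_ennreal2) (auto simp: ennreal_less_iff suminf_nonneg)
        have le: "w i \<le> \<delta> powr (1 - s) * w i powr s" for i
        proof -
          have "w i = w i powr (1 - s) * w i powr s"
            using w(1)[of i] by (simp flip: powr_add)
          also have "\<dots> \<le> \<delta> powr (1 - s) * w i powr s"
            using w[of i] s by (intro mult_right_mono powr_mono2) auto
          finally show ?thesis .
        qed
        have sm': "summable (\<lambda>i. \<delta> powr (1 - s) * w i powr s)"
          using sm by (rule summable_mult)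
        then have "summable w"
          using w le by (intro summable_comparison_test'[OF sm', of 0]) auto
        have "(\<Sum>i. w i) \<le> (\<Sum>i. \<delta> powr (1 - s) * w i powr s)"
          using le \<open>summable w\<close> sm' by (rule suminf_le)
        also have "\<dots> = \<delta> powr (1 - s) * (\<Sum>i. w i powr s)"
          using sm by (rule suminf_mult)
        also have "\<dots> < \<delta> powr (1 - s) * M"
          using sum \<delta> by (intro mult_strict_left_mono) auto
        finally have "(\<Sum>i. w i) < 1" using \<delta> by simp
        moreover have "w i \<le> 1" for i using w(2)[of i] \<delta> by simp
        ultimately obtain x where "x \<in> luroth_limsup \<tau>" "\<And>i. x \<notin> {a i..a i + w i}"
          using luroth_limsup_not_covered[OF \<tau> w(1) _ sm[unfolded s_def] \<open>summable w\<close>] by metis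
        with U(1) a show False by blast
      qed
    qed
    also have "\<dots> \<le> hausdorff_measure s (luroth_limsup \<tau>)"
      unfolding hausdorff_measure_def using \<delta> by (intro SUP_upper) simp
    finally show ?thesis .
  qed
  note large = this
  have "hausdorff_measure s (luroth_limsup \<tau>) = top"
  proof (rule ccontr)
    assume "hausdorff_measure s (luroth_limsup \<tau>) \<noteq> top"
    then obtain r where r: "0 \<le> r" "hausdorff_measure s (luroth_limsup \<tau>) = ennreal r"
      by (cases "hausdorff_measure s (luroth_limsup \<tau>)") auto
    then show False using large[of "r + 1"] by simp
  qed
  then show ?thesis by (simp add: s_def)
qed

text \<open>The measure claim carries the condition \<open>0 < \<tau>\<close>: at
  \<open>\<tau> = 0\<close> the exponent is 1, and \<open>hausdorff_measure_1_le_1\<close> bounds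
  the measure by 1.\<close>

theorem theorem2:
  fixes \<tau> :: real
  assumes "0 \<le> \<tau>"
  shows "hausdorff_dim (luroth_limsup \<tau>) = ennreal (1 / (1 + \<tau>)) \<and>
         (0 < \<tau> \<longrightarrow> hausdorff_measure (1 / (1 + \<tau>)) (luroth_limsup \<tau>) = \<infinity>)"
proof (intro conjI impI)
  show "hausdorff_measure (1 / (1 + \<tau>)) (luroth_limsup \<tau>) = \<infinity>" if "0 < \<tau>"
    using that by (rule hausdorff_measure_luroth_limsup_eq_top)
  let ?S = "{s. 0 \<le> s \<and> hausdorff_measure s (luroth_limsup \<tau>) = 0}"
  show "hausdorff_dim (luroth_limsup \<tau>) = ennreal (1 / (1 + \<tau>))"
  proof (rule antisym)
    show "hausdorff_dim (luroth_limsup \<tau>) \<le> ennreal (1 / (1 + \<tau>))"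
    proof (rule ennreal_le_epsilon)
      fix e :: real assume "0 < e"
      then have "hausdorff_measure (1 / (1 + \<tau>) + e) (luroth_limsup \<tau>) = 0"
        using assms by (intro hausdorff_measure_luroth_limsup_eq_0) auto
      then have "hausdorff_dim (luroth_limsup \<tau>) \<le> ennreal (1 / (1 + \<tau>) + e)"
        unfolding hausdorff_dim_def using assms \<open>0 < e\<close> by (intro INF_lower) auto
      then show "hausdorff_dim (luroth_limsup \<tau>) \<le> ennreal (1 / (1 + \<tau>)) + ennreal e"
        using assms \<open>0 < e\<close> by simp
    qed
    show "ennreal (1 / (1 + \<tau>)) \<le> hausdorff_dim (luroth_limsup \<tau>)"
      unfolding hausdorff_dim_def
    proof (intro INF_greatest ennreal_leI, rule ccontr)
      fix s assume s: "s \<in> ?S" "\<not> 1 / (1 + \<tau>) \<le> s"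
      \<comment> \<open>Larger parameters give subsets, so the measure is infinite at their critical
        exponents too; for \<open>\<tau> = 0\<close> these exponents still approach 1.\<close>
      have top: "hausdorff_measure (1 / (1 + \<tau>')) (luroth_limsup \<tau>) = \<infinity>" if "0 < \<tau>'" "\<tau> \<le> \<tau>'" for \<tau>'
        using hausdorff_measure_luroth_limsup_eq_top[OF that(1)]
          hausdorff_measure_mono[OF luroth_limsup_antimono[OF assms that(2)], of "1 / (1 + \<tau>')"]
        by (simp add: top_unique)
      show False
      proof (cases "s = 0")
        case True
        \<comment> \<open>The empty set has measure 0 at a positive exponent, contrary to
          \<open>top\<close>.\<close>
        have "luroth_limsup \<tau> \<noteq> {}"
        proof
          assume "luroth_limsup \<tau> = {}"
          then have "hausdorff_measure (1 / (1 + (\<tau> + 1))) (luroth_limsup \<tau>) = 0"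
            using assms by (intro hausdorff_measure_limsup_eq_0[where U = "\<lambda>_. {}"]) auto
          then show False using top[of "\<tau> + 1"] assms by simp
        qed
        from hausdorff_measure_0_ge_1[OF this] s(1) True show False by simp
      next
        case False
        with s have "0 < s" "s < 1 / (1 + \<tau>)" by auto
        \<comment> \<open>The exponent \<open>s\<close> is critical for the parameter
          \<open>1 / s - 1\<close>, which exceeds \<open>\<tau>\<close>.\<close>
        then have "1 + \<tau> < 1 / s" using assms by (simp add: field_simps)
        then show False using top[of "1 / s - 1"] assms s(1) by simp
      qed
    qed
  qed
qed

end
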